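(* Let $\mathcal{V},\mathcal{W}$ be separable Hilbert spaces, $A:\mathcal{V}\to\mathcal{W}$ a bounded linear operator, $d\in\mathcal{W}$, and $f:\mathcal{V}\to[0,\infty]$ a functional. Set $$\mathcal{J}(x)=f(x)+\frac12\|Ax-d\|_{\mathcal{W}}^2,\qquad \mathcal{J}_\gamma(x)=\mathcal{S}_\gamma^2(f)(x)+\frac12\|Ax-d\|_{\mathcal{W}}^2,\qquad x\in\mathcal{V}.$$ For every $\gamma>0$ such that $A^*A\leq\gamma I$ we have $$CE(\mathcal{J})\leq\mathcal{J}_\gamma\leq\mathcal{J}.$$
   Context: Hilbert spaces are over $\mathbb{R}$ or $\mathbb{C}$; complex ones are regarded as real Hilbert spaces with scalar product $\mathrm{Re}\langle x,y\rangle$. For an extended-real-valued functional $g$ on $\mathcal{V}$ and $\gamma>0$, $\mathcal{S}_\gamma(g)(y)=\sup_{x\in\mathcal{V}}\left(-g(x)-\frac{\gamma}{2}\|x-y\|_{\mathcal{V}}^2\right)$ and $\mathcal{S}_\gamma^2=\mathcal{S}_\gamma\circ\mathcal{S}_\gamma$. $CE(g)$ is the lower semi-continuous convex envelope of $g$, i.e. its largest lower semi-continuous convex minorant. $A^*A\le\gamma I$ means $\|Ax\|_{\mathcal{W}}^2\le\gamma\|x\|_{\mathcal{V}}^2$ for all $x\in\mathcal{V}$. *)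

theory Defs
  imports "HOL-Analysis.Analysis"
begin

text \<open>
  Hilbert spaces are types of class \<open>{real_inner, complete_space}\<close>.  A complex Hilbert space is
  covered as its underlying real Hilbert space with inner product \<open>Re \<langle>x, y\<rangle>\<close>, which has the same
  norm and topology; a bounded complex-linear operator is in particular bounded and real-linear.
\<close>

definition S_transform :: "real \<Rightarrow> ('v::real_inner \<Rightarrow> ereal) \<Rightarrow> 'v \<Rightarrow> ereal"
  where "S_transform \<gamma> g y = (SUP x. - g x - ereal (\<gamma> / 2 * (norm (x - y))\<^sup>2))"

text \<open>
  Convexity of an extended-real-valued function is convexity of its epigraph in
  \<open>V \<times> \<real>\<close>; this avoids the undefined sum \<open>\<infinity> + (-\<infinity>)\<close> in the usual inequality.
\<close>

definition convex_ereal :: "('v::real_vector \<Rightarrow> ereal) \<Rightarrow> bool"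
  where "convex_ereal g \<longleftrightarrow> convex {(x, r::real). g x \<le> ereal r}"

definition lower_semicontinuous :: "('v::topological_space \<Rightarrow> ereal) \<Rightarrow> bool"
  where "lower_semicontinuous g \<longleftrightarrow> (\<forall>x. g x \<le> Liminf (at x) g)"

definition lsc_convex_minorant :: "('v::real_normed_vector \<Rightarrow> ereal) \<Rightarrow> ('v \<Rightarrow> ereal) \<Rightarrow> bool"
  where "lsc_convex_minorant g h \<longleftrightarrow> lower_semicontinuous h \<and> convex_ereal h \<and> h \<le> g"

text \<open>\<open>CE g\<close> is the greatest element in the pointwise order; it exists by \<open>CE_greatest\<close> below.\<close>

definition CE :: "('v::real_normed_vector \<Rightarrow> ereal) \<Rightarrow> 'v \<Rightarrow> ereal"
  where "CE g = (GREATEST h. lsc_convex_minorant g h)"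

definition least_squares_penalized ::
    "('v::real_normed_vector \<Rightarrow> 'w::real_normed_vector) \<Rightarrow> 'w \<Rightarrow> ('v \<Rightarrow> ereal) \<Rightarrow> 'v \<Rightarrow> ereal"
  where "least_squares_penalized A d g x = g x + ereal (1 / 2 * (norm (A x - d))\<^sup>2)"

lemma lsc_convex_minorant_Sup:
  "lsc_convex_minorant g (Sup {h. lsc_convex_minorant g h})"
  (is "lsc_convex_minorant g (Sup ?M)")
proof (rule lsc_convex_minorant_def[THEN iffD2], intro conjI)
  show "lower_semicontinuous (Sup ?M)"
    unfolding lower_semicontinuous_def
  proof (rule allI)
    fix x
    have "h x \<le> Liminf (at x) (Sup ?M)" if "h \<in> ?M" for h
    proof -
      have "h x \<le> Liminf (at x) h"
        using that by (auto simp: lsc_convex_minorant_def lower_semicontinuous_def)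
      also have "\<dots> \<le> Liminf (at x) (Sup ?M)"
        by (intro Liminf_mono always_eventually allI le_funD[OF Sup_upper[OF that]])
      finally show ?thesis .
    qed
    then show "Sup ?M x \<le> Liminf (at x) (Sup ?M)"
      by (auto simp: Sup_apply intro: SUP_least)
  qed
  have "{(x, r::real). Sup ?M x \<le> ereal r} = (\<Inter>h\<in>?M. {(x, r). h x \<le> ereal r})"
    by (auto simp: Sup_apply SUP_le_iff)
  moreover have "convex (\<Inter>h\<in>?M. {(x, r::real). h x \<le> ereal r})"
    by (rule convex_INT) (simp add: lsc_convex_minorant_def convex_ereal_def)
  ultimately show "convex_ereal (Sup ?M)"
    by (simp add: convex_ereal_def)
  show "Sup ?M \<le> g"
    by (rule Sup_least) (simp add: lsc_convex_minorant_def)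
qed

lemma CE_eq_Sup: "CE g = Sup {h. lsc_convex_minorant g h}"
  unfolding CE_def
  by (rule Greatest_equality) (auto intro: lsc_convex_minorant_Sup Sup_upper)

lemma CE_greatest:
  "lsc_convex_minorant g (CE g)"
  "lsc_convex_minorant g h \<Longrightarrow> h \<le> CE g"
  by (auto simp: CE_eq_Sup intro: lsc_convex_minorant_Sup Sup_upper)

end

theory Submission
  imports Defs
begin

text \<open>
  Put \<open>q x = \<gamma>/2 \<parallel>x\<parallel>\<^sup>2 - 1/2 \<parallel>A x - d\<parallel>\<^sup>2\<close>, which is convex because \<open>A\<^sup>*A \<le> \<gamma> I\<close>.  Then
  \<open>CE J + q\<close> is convex, lower semicontinuous and below \<open>f + \<gamma>/2 \<parallel>\<cdot>\<parallel>\<^sup>2\<close>.  It is the supremum of its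
  affine minorants, and every function \<open>affine - \<gamma>/2 \<parallel>\<cdot>\<parallel>\<^sup>2\<close> below \<open>f\<close> is also below
  \<open>S\<^sub>\<gamma>\<^sup>2 f\<close>; subtracting \<open>q\<close> again gives \<open>CE J \<le> J\<^sub>\<gamma>\<close>.  Affine minorants come from
  subgradients at proximal points, whose existence follows from the parallelogram law and completeness.
\<close>

section \<open>Squared norms, proximal points, affine minorants and closed epigraphs\<close>

text \<open>The exact convexity defect of the squared norm. With weights 1/2 it is the parallelogram
  law behind proximal points; with general weights it yields the convexity of
  \<open>q\<close>.\<close>

lemma norm_convex_combination:
  fixes x y :: "'a::real_inner"
  assumes "u + v = 1"
  shows "(norm (u *\<^sub>R x + v *\<^sub>R y))\<^sup>2 = u * (norm x)\<^sup>2 + v * (norm y)\<^sup>2 - u * v * (norm (x - y))\<^sup>2"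
proof -
  have v: "v = 1 - u" using assms by simp
  show ?thesis
    unfolding v power2_norm_eq_inner
    by (simp add: inner_add_left inner_add_right inner_diff_left inner_diff_right
        inner_commute[of y x] algebra_simps)
qed

text \<open>\<open>E\<close> stands for the epigraph of a function that may take infinite values, so
  the objective stays real. The quadratic term is strongly convex, which makes the first components
  of a minimizing sequence Cauchy; the second components then converge because the objective values
  do.\<close>

lemma prox_attained:
  fixes E :: "('v::{real_inner, complete_space} \<times> real) set"
  assumes "closed E" "convex E" "E \<noteq> {}" and "k > 0"
    and bound: "\<And>z s. (z, s) \<in> E \<Longrightarrow> b \<le> s + k / 2 * (norm (z - x))\<^sup>2"
  obtains p m where "(p, m) \<in> E"
    "\<And>z s. (z, s) \<in> E \<Longrightarrow> m + k / 2 * (norm (p - x))\<^sup>2 \<le> s + k / 2 * (norm (z - x))\<^sup>2"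
proof -
  define \<phi> where "\<phi> = (\<lambda>w::'v \<times> real. snd w + k / 2 * (norm (fst w - x))\<^sup>2)"
  define \<mu> where "\<mu> = Inf (\<phi> ` E)"
  have bdd: "bdd_below (\<phi> ` E)"
    using bound by (intro bdd_belowI[of _ b]) (auto simp: \<phi>_def)
  have \<mu>_le: "\<mu> \<le> \<phi> w" if "w \<in> E" for w
    unfolding \<mu>_def using bdd that by (intro cInf_lower) auto
  have ex: "\<exists>w\<in>E. \<phi> w < \<mu> + 1 / real (Suc n)" for n
    using cInf_lessD[of "\<phi> ` E" "\<mu> + 1 / real (Suc n)"] \<open>E \<noteq> {}\<close> by (auto simp: \<mu>_def)
  then obtain w where wE: "\<And>n. w n \<in> E" and w: "\<And>n. \<phi> (w n) < \<mu> + 1 / real (Suc n)"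
    by metis
  define z where "z = (\<lambda>n. fst (w n))"
  \<comment> \<open>Comparing \<open>\<mu>\<close> with the value at the midpoint bounds the
    distance of two points by their excess over the infimum.\<close>
  have mid: "k / 8 * (norm (fst a - fst b))\<^sup>2 \<le> (\<phi> a + \<phi> b) / 2 - \<mu>"
    if "a \<in> E" "b \<in> E" for a b
  proof -
    let ?c = "(1/2) *\<^sub>R a + (1/2) *\<^sub>R b"
    have "?c \<in> E" using \<open>convex E\<close> that by (intro convexD) auto
    then have "\<mu> \<le> \<phi> ?c" by (rule \<mu>_le)
    moreover have "fst ?c - x = (1/2) *\<^sub>R (fst a - x) + (1/2) *\<^sub>R (fst b - x)"
      by (simp add: algebra_simps flip: scaleR_left_distrib)
    then have "\<phi> ?c = (\<phi> a + \<phi> b) / 2 - k / 8 * (norm (fst a - fst b))\<^sup>2"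
      using norm_convex_combination[of "1/2" "1/2" "fst a - x" "fst b - x"]
      by (simp add: \<phi>_def right_diff_distrib distrib_left add_divide_distrib)
    ultimately show ?thesis by linarith
  qed
  have "Cauchy z"
  proof (rule metric_CauchyI)
    fix e :: real assume "e > 0"
    \<comment> \<open>This tolerance is matched to \<open>mid\<close>: excesses below it force
      distances below \<open>e\<close>.\<close>
    then have "k / 8 * e\<^sup>2 > 0" using \<open>k > 0\<close> by simp
    then obtain N where N: "1 / real (Suc N) < k / 8 * e\<^sup>2"
      by (meson nat_approx_posE)
    have "dist (z i) (z j) < e" if "i \<ge> N" "j \<ge> N" for i j
    proof -
      have near: "\<phi> (w l) < \<mu> + k / 8 * e\<^sup>2" if "l \<ge> N" for l
      proof -
        have "1 / real (Suc l) \<le> 1 / real (Suc N)" using that by (simp add: frac_le)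
        also note N
        finally have "\<mu> + 1 / real (Suc l) < \<mu> + k / 8 * e\<^sup>2" by (rule add_strict_left_mono)
        with w[of l] show ?thesis by (rule less_trans)
      qed
      have "k / 8 * (norm (z i - z j))\<^sup>2 < k / 8 * e\<^sup>2"
        using mid[OF wE wE, of i j] near[OF that(1)] near[OF that(2)]
        unfolding z_def by argo
      then have "(norm (z i - z j))\<^sup>2 < e\<^sup>2" using \<open>k > 0\<close> by simp
      then show ?thesis
        using \<open>e > 0\<close> by (simp add: dist_norm power2_less_imp_less)
    qed
    then show "\<exists>M. \<forall>i\<ge>M. \<forall>j\<ge>M. dist (z i) (z j) < e" by blast
  qed
  then obtain p where p: "z \<longlonglongrightarrow> p"
    using Cauchy_convergent_iff convergent_def by blast
  have "(\<lambda>n. \<mu> + 1 / real (Suc n)) \<longlonglongrightarrow> \<mu> + 0"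
    by (intro tendsto_intros LIMSEQ_Suc[OF lim_1_over_n])
  then have lim: "(\<lambda>n. \<mu> + 1 / real (Suc n)) \<longlonglongrightarrow> \<mu>" by (simp only: add_0_right)
  have "(\<lambda>n. \<phi> (w n)) \<longlonglongrightarrow> \<mu>"
  proof (rule real_tendsto_sandwich[OF _ _ tendsto_const lim])
    show "\<forall>\<^sub>F n in sequentially. \<mu> \<le> \<phi> (w n)"
      using \<mu>_le[OF wE] by (rule always_eventually[OF allI])
    show "\<forall>\<^sub>F n in sequentially. \<phi> (w n) \<le> \<mu> + 1 / real (Suc n)"
      using less_imp_le[OF w] by (rule always_eventually[OF allI])
  qed
  then have "(\<lambda>n. \<phi> (w n) - k / 2 * (norm (z n - x))\<^sup>2) \<longlonglongrightarrow> \<mu> - k / 2 * (norm (p - x))\<^sup>2"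
    by (intro tendsto_intros p)
  then have "(\<lambda>n. snd (w n)) \<longlonglongrightarrow> \<mu> - k / 2 * (norm (p - x))\<^sup>2"
    by (simp add: \<phi>_def z_def)
  with p have "(\<lambda>n. (z n, snd (w n))) \<longlonglongrightarrow> (p, \<mu> - k / 2 * (norm (p - x))\<^sup>2)"
    by (rule tendsto_Pair)
  then have "w \<longlonglongrightarrow> (p, \<mu> - k / 2 * (norm (p - x))\<^sup>2)"
    by (simp add: z_def)
  then have "(p, \<mu> - k / 2 * (norm (p - x))\<^sup>2) \<in> E"
    using \<open>closed E\<close> wE closed_sequentially by blast
  then show thesis
    using \<mu>_le by (intro that[of p "\<mu> - k / 2 * (norm (p - x))\<^sup>2"]) (auto simp: \<phi>_def)
qed

text \<open>First-order optimality: moving from \<open>p\<close> towards \<open>z\<close> by a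
  fraction \<open>t\<close> cannot lower the objective. After division by \<open>t\<close>, only an
  error \<open>t * D\<close> separates this from the subgradient inequality.\<close>

lemma prox_subgradient:
  fixes E :: "('v::real_inner \<times> real) set"
  assumes "convex E" "(p, m) \<in> E" "(z, s) \<in> E" "k > 0"
    and min: "\<And>z s. (z, s) \<in> E \<Longrightarrow> m + k / 2 * (norm (p - x))\<^sup>2 \<le> s + k / 2 * (norm (z - x))\<^sup>2"
  shows "m + k * inner (x - p) (z - p) \<le> s"
proof (rule field_le_epsilon)
  fix e :: real assume "e > 0"
  define D where "D = k / 2 * (norm (z - p))\<^sup>2"
  have "D \<ge> 0" using \<open>k > 0\<close> by (simp add: D_def)
  \<comment> \<open>The bound 1 keeps the combination convex, the other bound gives
    \<open>t * D \<le> e\<close>; the summand 1 covers \<open>D = 0\<close>.\<close>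
  define t where "t = min 1 (e / (D + 1))"
  have t: "t > 0" "t \<le> 1" using \<open>e > 0\<close> \<open>D \<ge> 0\<close> by (auto simp: t_def)
  have "t * D \<le> e / (D + 1) * D"
    using \<open>D \<ge> 0\<close> by (intro mult_right_mono) (auto simp: t_def)
  also have "\<dots> \<le> e" using \<open>e > 0\<close> \<open>D \<ge> 0\<close> by (simp add: field_simps)
  finally have tD: "t * D \<le> e" .
  have "(1 - t) *\<^sub>R (p, m) + t *\<^sub>R (z, s) \<in> E"
    using assms t by (intro convexD) auto
  then have "((1 - t) *\<^sub>R p + t *\<^sub>R z, (1 - t) * m + t * s) \<in> E" by simp
  from min[OF this] have
    "m + k / 2 * (norm (p - x))\<^sup>2 \<le> (1 - t) * m + t * s + k / 2 * (norm ((1 - t) *\<^sub>R p + t *\<^sub>R z - x))\<^sup>2" .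
  moreover have "(1 - t) *\<^sub>R p + t *\<^sub>R z - x = (p - x) + t *\<^sub>R (z - p)"
    by (simp add: algebra_simps)
  then have "(norm ((1 - t) *\<^sub>R p + t *\<^sub>R z - x))\<^sup>2
      = (norm (p - x))\<^sup>2 + 2 * t * inner (p - x) (z - p) + t\<^sup>2 * (norm (z - p))\<^sup>2"
    using dot_norm[of "p - x" "t *\<^sub>R (z - p)"]
    by (simp only: norm_scaleR inner_scaleR_right power_mult_distrib power2_abs) simp
  ultimately have "m + k / 2 * (norm (p - x))\<^sup>2 \<le> (1 - t) * m + t * s
      + k / 2 * ((norm (p - x))\<^sup>2 + 2 * t * inner (p - x) (z - p) + t\<^sup>2 * (norm (z - p))\<^sup>2)"
    by (simp only:)
  then have "0 \<le> t * (s - m + k * inner (p - x) (z - p) + t * D)"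
    unfolding D_def
    by (simp add: left_diff_distrib right_diff_distrib distrib_left power2_eq_square mult.assoc
        mult.left_commute[of k t])
  then have "0 \<le> s - m + k * inner (p - x) (z - p) + t * D"
    using t by (simp add: zero_le_mult_iff)
  moreover have "inner (p - x) (z - p) = - inner (x - p) (z - p)"
    by (simp add: inner_diff_left)
  ultimately show "m + k * inner (x - p) (z - p) \<le> s + e" using tD by simp
qed

text \<open>Take the proximal point \<open>p\<close> of \<open>x\<close> with \<open>k\<close> so
  large that the penalized objective is at least \<open>r\<close> on \<open>E\<close>. The
  subgradient at \<open>p\<close> gives an affine minorant whose value at \<open>x\<close> is
  \<open>m + k * (norm (x - p))\<^sup>2\<close>, which is at least the minimal objective value and
  hence at least \<open>r\<close>.\<close>

lemma affine_minorant_through: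
  fixes E :: "('v::{real_inner, complete_space} \<times> real) set"
  assumes "closed E" "convex E"
    and up: "\<And>z s t. (z, s) \<in> E \<Longrightarrow> s \<le> t \<Longrightarrow> (z, t) \<in> E"
    and bound: "\<And>z s. (z, s) \<in> E \<Longrightarrow> - a - b * norm z \<le> s" and "b \<ge> 0"
    and "(x, r) \<notin> E"
  obtains y c where "\<And>z s. (z, s) \<in> E \<Longrightarrow> c + inner y z \<le> s" "r \<le> c + inner y x"
proof (cases "E = {}")
  case True
  then show thesis by (intro that[of r 0]) auto
next
  case False
  have "open (- E)" "(x, r) \<in> - E" using assms by auto
  then obtain U V where UV: "open U" "open V" "(x, r) \<in> U \<times> V" "U \<times> V \<subseteq> - E"
    by (rule open_prod_elim)
  then obtain \<delta> where \<delta>: "\<delta> > 0" "ball x \<delta> \<subseteq> U"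
    by (meson mem_Sigma_iff open_contains_ball)
  \<comment> \<open>Near \<open>x\<close> a point of \<open>E\<close> at height at most
    \<open>r\<close> could be raised to height \<open>r\<close>, into the box that misses
    \<open>E\<close>.\<close>
  have near: "r < s" if "(z, s) \<in> E" "norm (z - x) < \<delta>" for z s
  proof (rule ccontr)
    assume "\<not> r < s"
    then have "(z, r) \<in> E" using up that by simp
    moreover have "z \<in> U" using \<delta> that by (auto simp: dist_norm norm_minus_commute)
    ultimately show False using UV by auto
  qed
  \<comment> \<open>At distance \<open>t\<close> from \<open>x\<close>, \<open>bound\<close> gives
    \<open>r - s \<le> C + b * t\<close>. For \<open>t \<ge> \<delta>\<close> both terms are
    dominated by multiples of the square of \<open>t\<close>, whose coefficients determine
    \<open>k\<close>; the final 1 in \<open>k\<close> ensures positivity.\<close>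
  define C where "C = \<bar>r\<bar> + \<bar>a\<bar> + b * norm x"
  have "C \<ge> 0" using \<open>b \<ge> 0\<close> by (simp add: C_def)
  define k where "k = 2 * (C / \<delta>\<^sup>2 + b / \<delta>) + 1"
  have "k > 0" using \<open>C \<ge> 0\<close> \<open>b \<ge> 0\<close> \<delta> by (auto simp: k_def intro!: add_nonneg_pos)
  have far: "r \<le> s + k / 2 * (norm (z - x))\<^sup>2" if "(z, s) \<in> E" for z s
  proof (cases "norm (z - x) < \<delta>")
    case True
    moreover have "0 \<le> k / 2 * (norm (z - x))\<^sup>2" using \<open>k > 0\<close> by simp
    ultimately show ?thesis using near[OF that] by linarith
  next
    case False
    define t where "t = norm (z - x)"
    have t: "t \<ge> \<delta>" using False by (simp add: t_def)
    have "norm z \<le> norm x + t" unfolding t_def by norm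
    then have "b * norm z \<le> b * norm x + b * t"
      using \<open>b \<ge> 0\<close> by (metis mult_left_mono distrib_left)
    then have "r - s \<le> C + b * t" using bound[OF that] by (simp add: C_def)
    also have "C \<le> C / \<delta>\<^sup>2 * t\<^sup>2"
    proof -
      have "\<delta>\<^sup>2 \<le> t\<^sup>2" using t \<delta> by (intro power_mono) auto
      then show ?thesis using \<open>C \<ge> 0\<close> \<delta> by (simp add: field_simps mult_left_mono)
    qed
    also have "b * t \<le> b / \<delta> * t\<^sup>2"
    proof -
      have "b * t * \<delta> \<le> b * t * t" using t \<delta> \<open>b \<ge> 0\<close> by (intro mult_left_mono) auto
      then show ?thesis using \<delta> by (simp add: field_simps power2_eq_square)
    qed
    finally have "r - s \<le> C / \<delta>\<^sup>2 * t\<^sup>2 + b / \<delta> * t\<^sup>2" by simp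
    also have "\<dots> = (k - 1) / 2 * t\<^sup>2" by (simp add: k_def field_simps add_divide_distrib)
    also have "\<dots> \<le> k / 2 * t\<^sup>2" by (intro mult_right_mono) auto
    finally show ?thesis by (simp add: t_def)
  qed
  obtain p m where pm: "(p, m) \<in> E"
    "\<And>z s. (z, s) \<in> E \<Longrightarrow> m + k / 2 * (norm (p - x))\<^sup>2 \<le> s + k / 2 * (norm (z - x))\<^sup>2"
    using prox_attained[OF \<open>closed E\<close> \<open>convex E\<close> False \<open>k > 0\<close> far] by metis
  show thesis
  proof (rule that[of "m - k * inner (x - p) p" "k *\<^sub>R (x - p)"])
    fix z s assume "(z, s) \<in> E"
    then have "m + k * inner (x - p) (z - p) \<le> s"
      using prox_subgradient[OF \<open>convex E\<close> pm(1) _ \<open>k > 0\<close> pm(2)] by blast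
    then show "m - k * inner (x - p) p + inner (k *\<^sub>R (x - p)) z \<le> s"
      by (simp add: inner_diff_right algebra_simps)
  next
    have "r \<le> m + k / 2 * (norm (x - p))\<^sup>2"
      using far[OF pm(1)] by (simp add: norm_minus_commute)
    also have "\<dots> \<le> m + k * (norm (x - p))\<^sup>2" using \<open>k > 0\<close> by (simp add: mult_right_mono)
    also have "\<dots> = m - k * inner (x - p) p + inner (k *\<^sub>R (x - p)) x"
      unfolding power2_norm_eq_inner by (simp add: inner_diff_right algebra_simps)
    finally show "r \<le> m - k * inner (x - p) p + inner (k *\<^sub>R (x - p)) x" .
  qed
qed

text \<open>For a point \<open>(x, r)\<close> off the epigraph, a level \<open>r'\<close> strictly
  between \<open>r\<close> and \<open>g x\<close> gives an open box
  \<open>U \<times> {..<r'}\<close> in the complement.\<close>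

lemma lower_semicontinuous_closed_epigraph:
  fixes g :: "'v::topological_space \<Rightarrow> ereal"
  assumes "lower_semicontinuous g"
  shows "closed {(x, r::real). g x \<le> ereal r}"
proof -
  have "\<exists>T. open T \<and> w \<in> T \<and> T \<subseteq> - {(x, r::real). g x \<le> ereal r}"
    if "w \<in> - {(x, r::real). g x \<le> ereal r}" for w
  proof -
    obtain x r where w: "w = (x, r)" by (cases w)
    with that have "ereal r < g x" by auto
    then obtain r' where r': "ereal r < ereal r'" "ereal r' < g x" using ereal_dense2 by blast
    have "g x \<le> Liminf (at x) g" using assms by (simp add: lower_semicontinuous_def)
    with r'(2) have "ereal r' < Liminf (at x) g" by (rule less_le_trans)
    then have "eventually (\<lambda>y. ereal r' < g y) (at x)" by (rule less_LiminfD)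
    then obtain U where U: "open U" "x \<in> U" "\<And>y. y \<in> U \<Longrightarrow> y \<noteq> x \<Longrightarrow> ereal r' < g y"
      by (auto simp: eventually_at_topological)
    \<comment> \<open>The filter \<open>at x\<close> is punctured, so \<open>y = x\<close> is
      covered by the choice of \<open>r'\<close> instead.\<close>
    have "ereal s < g y" if "y \<in> U" "s < r'" for y s
      using U(3)[OF that(1)] r'(2) that(2)
      by (cases "y = x") (auto intro: less_trans[of "ereal s" "ereal r'"])
    then have "U \<times> {..<r'} \<subseteq> - {(x, r::real). g x \<le> ereal r}"
      by (auto simp flip: not_less)
    moreover have "open (U \<times> {..<r'})" using U by (intro open_Times) auto
    ultimately show ?thesis using U r' w by (intro exI[of _ "U \<times> {..<r'}"]) auto
  qed
  then show ?thesis
    unfolding closed_def by (rule Topological_Spaces.openI)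
qed

section \<open>Bounds for the double transform\<close>

text \<open>A Fenchel-type inequality: the inner supremum at \<open>y\<close> is at least its term
  at \<open>x\<close>, and the two quadratic penalties cancel.\<close>

lemma S_transform_twice_le:
  "S_transform \<gamma> (S_transform \<gamma> f) x \<le> f x"
  unfolding S_transform_def[of \<gamma> "S_transform \<gamma> f"]
proof (rule SUP_least)
  fix y
  have "- f x - ereal (\<gamma> / 2 * (norm (x - y))\<^sup>2) \<le> S_transform \<gamma> f y"
    unfolding S_transform_def by (rule SUP_upper) simp
  then show "- S_transform \<gamma> f y - ereal (\<gamma> / 2 * (norm (y - x))\<^sup>2) \<le> f x"
    by (cases "f x"; cases "S_transform \<gamma> f y") (auto simp: norm_minus_commute)
qed

text \<open>Completing the square turns the minorant into a constant minus
  \<open>\<gamma> / 2 * (norm (x - y))\<^sup>2\<close>. This bounds the inner transform at the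
  centre \<open>y\<close>, and the outer supremum is tested at that same \<open>y\<close>.\<close>

lemma S_transform_twice_ge:
  assumes "\<And>x. ereal (c + \<gamma> * inner y x - \<gamma> / 2 * (norm x)\<^sup>2) \<le> f x"
  shows "ereal (c + \<gamma> * inner y x - \<gamma> / 2 * (norm x)\<^sup>2) \<le> S_transform \<gamma> (S_transform \<gamma> f) x"
proof -
  have sq: "\<gamma> / 2 * (norm (z - y))\<^sup>2 = \<gamma> / 2 * (norm z)\<^sup>2 - \<gamma> * inner y z + \<gamma> / 2 * (norm y)\<^sup>2" for z
    unfolding power2_norm_eq_inner
    by (simp add: inner_diff_left inner_diff_right inner_commute algebra_simps)
  have "S_transform \<gamma> f y \<le> ereal (- c - \<gamma> / 2 * (norm y)\<^sup>2)"
    unfolding S_transform_def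
  proof (rule SUP_least)
    fix z
    show "- f z - ereal (\<gamma> / 2 * (norm (z - y))\<^sup>2) \<le> ereal (- c - \<gamma> / 2 * (norm y)\<^sup>2)"
      using assms[of z] unfolding sq by (cases "f z") auto
  qed
  then have "ereal (c + \<gamma> * inner y x - \<gamma> / 2 * (norm x)\<^sup>2)
      \<le> - S_transform \<gamma> f y - ereal (\<gamma> / 2 * (norm (y - x))\<^sup>2)"
    unfolding norm_minus_commute[of y x] sq by (cases "S_transform \<gamma> f y") auto
  also have "\<dots> \<le> S_transform \<gamma> (S_transform \<gamma> f) x"
    unfolding S_transform_def[of \<gamma> "S_transform \<gamma> f"] by (rule SUP_upper) simp
  finally show ?thesis .
qed

section \<open>Comparison with the convex envelope\<close>

text \<open>The zero function is an admissible minorant. Nonnegativity later supplies the lower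
  growth bound for the epigraph \<open>E\<close>.\<close>

lemma CE_nonneg:
  assumes "\<And>x. 0 \<le> g x"
  shows "0 \<le> CE g x"
proof -
  have "{(x::'a, r::real). 0 \<le> ereal r} = UNIV \<times> {0..}" by auto
  then have "convex {(x::'a, r::real). 0 \<le> ereal r}"
    by (simp add: convex_Times)
  moreover have "0 \<le> Liminf (at x) (\<lambda>_. 0::ereal)" for x :: 'a
    by (rule Liminf_bounded) simp
  ultimately have "lsc_convex_minorant g (\<lambda>_. 0)"
    using assms by (simp add: lsc_convex_minorant_def lower_semicontinuous_def convex_ereal_def le_fun_def)
  then show ?thesis using CE_greatest(2) le_funD by fastforce
qed

lemma CE_least_squares_le:
  fixes A :: "'v::{real_inner, complete_space} \<Rightarrow> 'w::real_inner"
  assumes "bounded_linear A" and f: "\<And>x. 0 \<le> f x" and "\<gamma> > 0"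
    and A: "\<And>x. (norm (A x))\<^sup>2 \<le> \<gamma> * (norm x)\<^sup>2"
  shows "CE (least_squares_penalized A d f) x
    \<le> least_squares_penalized A d (S_transform \<gamma> (S_transform \<gamma> f)) x"
proof (rule ccontr)
  interpret A: bounded_linear A by fact
  define J where "J = least_squares_penalized A d f"
  define h where "h = CE J"
  define q where "q = (\<lambda>x. \<gamma> / 2 * (norm x)\<^sup>2 - 1 / 2 * (norm (A x - d))\<^sup>2)"
  \<comment> \<open>The epigraph of \<open>h + q\<close>, with the real number \<open>q x\<close>
    moved to the right.\<close>
  define E where "E = {(x, s). h x \<le> ereal (s - q x)}"
  have minor: "lower_semicontinuous h" "convex_ereal h" "h \<le> J"
    using CE_greatest(1)[of J] by (auto simp: h_def lsc_convex_minorant_def)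
  have h0: "0 \<le> h z" for z
    unfolding h_def by (rule CE_nonneg) (auto simp: J_def least_squares_penalized_def f)

  have q_convex: "q (u *\<^sub>R y + v *\<^sub>R z) \<le> u * q y + v * q z"
    if "u \<ge> 0" "v \<ge> 0" "u + v = 1" for u v y z
  proof -
    have "d = u *\<^sub>R d + v *\<^sub>R d" using that by (simp flip: scaleR_left_distrib)
    then have "A (u *\<^sub>R y + v *\<^sub>R z) - d = u *\<^sub>R (A y - d) + v *\<^sub>R (A z - d)"
      by (simp add: A.add A.scaleR algebra_simps)
    then have "(norm (A (u *\<^sub>R y + v *\<^sub>R z) - d))\<^sup>2
        = u * (norm (A y - d))\<^sup>2 + v * (norm (A z - d))\<^sup>2 - u * v * (norm (A (y - z)))\<^sup>2"
      using norm_convex_combination[OF that(3), of "A y - d" "A z - d"] by (simp add: A.diff)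
    \<comment> \<open>The convexity defects of the two quadratic terms combine into a multiple of
      the expression that the bound on \<open>A\<close> makes nonnegative.\<close>
    then have "q (u *\<^sub>R y + v *\<^sub>R z)
        = u * q y + v * q z - u * v * (\<gamma> * (norm (y - z))\<^sup>2 - (norm (A (y - z)))\<^sup>2) / 2"
      unfolding q_def norm_convex_combination[OF that(3)] by (simp add: field_simps)
    moreover have "0 \<le> u * v * (\<gamma> * (norm (y - z))\<^sup>2 - (norm (A (y - z)))\<^sup>2)"
      using that A[of "y - z"] by simp
    ultimately show ?thesis by simp
  qed

  have E_convex: "convex E"
  proof (rule convexI)
    fix a b :: "'v \<times> real" and u v :: real
    assume ab: "a \<in> E" "b \<in> E" and uv: "0 \<le> u" "0 \<le> v" "u + v = 1"
    obtain y s z t where a: "a = (y, s)" and b: "b = (z, t)" by (cases a, cases b)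
    have "u *\<^sub>R (y, s - q y) + v *\<^sub>R (z, t - q z) \<in> {(x, r::real). h x \<le> ereal r}"
      using minor(2) ab uv unfolding convex_ereal_def by (intro convexD) (auto simp: E_def a b)
    then have "h (u *\<^sub>R y + v *\<^sub>R z) \<le> ereal (u * (s - q y) + v * (t - q z))" by simp
    also have "\<dots> \<le> ereal (u * s + v * t - q (u *\<^sub>R y + v *\<^sub>R z))"
      using q_convex[OF uv, of y z] by (simp add: algebra_simps)
    finally show "u *\<^sub>R a + v *\<^sub>R b \<in> E" by (simp add: E_def a b)
  qed
  have E_closed: "closed E"
  proof -
    have "E = (\<lambda>w. (fst w, snd w - q (fst w))) -` {(x, r::real). h x \<le> ereal r}"
      by (auto simp: E_def)
    moreover have "continuous_on UNIV (\<lambda>w::'v \<times> real. (fst w, snd w - q (fst w)))"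
      unfolding q_def by (intro continuous_intros A.continuous_on)
    ultimately show ?thesis
      using lower_semicontinuous_closed_epigraph[OF minor(1)]
      by (simp only: closed_vimage)
  qed
  have E_up: "(z, t) \<in> E" if "(z, s) \<in> E" "s \<le> t" for z s t
    using that by (auto simp: E_def intro: order_trans)
  \<comment> \<open>Since \<open>h \<ge> 0\<close>, the height is at least \<open>q z\<close>. The
    bound on \<open>A\<close> makes the purely quadratic part of \<open>q\<close> nonnegative,
    leaving an affine term controlled by Cauchy-Schwarz.\<close>
  have E_bound: "- ((norm d)\<^sup>2 / 2) - norm d * sqrt \<gamma> * norm z \<le> s" if "(z, s) \<in> E" for z s
  proof -
    have "h z \<le> ereal (s - q z)" using that by (simp add: E_def)
    with h0[of z] have "0 \<le> ereal (s - q z)" by (rule order_trans)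
    then have "q z \<le> s" by simp
    have "norm (A z) \<le> sqrt (\<gamma> * (norm z)\<^sup>2)" using A by (rule real_le_rsqrt)
    then have "norm (A z) \<le> sqrt \<gamma> * norm z" by (simp add: real_sqrt_mult)
    then have "norm (A z) * norm d \<le> sqrt \<gamma> * norm z * norm d" by (rule mult_right_mono) simp
    moreover have "- inner (A z) d \<le> norm (A z) * norm d"
      using Cauchy_Schwarz_ineq2[of "A z" d] by simp
    moreover have "(norm (A z - d))\<^sup>2 = (norm (A z))\<^sup>2 - 2 * inner (A z) d + (norm d)\<^sup>2"
      unfolding power2_norm_eq_inner
      by (simp add: inner_diff_left inner_diff_right inner_commute algebra_simps)
    then have "inner (A z) d - (norm d)\<^sup>2 / 2 \<le> q z"
      unfolding q_def using A[of z] by argo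
    ultimately show ?thesis using \<open>q z \<le> s\<close> by (simp add: mult_ac)
  qed
  have b: "0 \<le> norm d * sqrt \<gamma>" using \<open>\<gamma> > 0\<close> by simp
  assume "\<not> ?thesis"
  then have "least_squares_penalized A d (S_transform \<gamma> (S_transform \<gamma> f)) x < h x"
    by (simp add: h_def J_def)
  then obtain \<rho> where \<rho>: "least_squares_penalized A d (S_transform \<gamma> (S_transform \<gamma> f)) x < ereal \<rho>"
      "ereal \<rho> < h x"
    using ereal_dense2 by blast
  then have "(x, \<rho> + q x) \<notin> E" by (simp add: E_def)
  with E_closed E_convex E_up E_bound b obtain y c where yc: "\<And>z s. (z, s) \<in> E \<Longrightarrow> c + inner y z \<le> s"
      and x: "\<rho> + q x \<le> c + inner y x"
    by (rule affine_minorant_through) blast+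
  \<comment> \<open>Rescaling the slope by \<gamma> gives the centre of the quadratic minorant in
    \<open>S_transform_twice_ge\<close>.\<close>
  have y: "\<gamma> * inner (y /\<^sub>R \<gamma>) z = inner y z" for z
    using \<open>\<gamma> > 0\<close> by (simp flip: mult.assoc)
  have "ereal (c + \<gamma> * inner (y /\<^sub>R \<gamma>) z - \<gamma> / 2 * (norm z)\<^sup>2) \<le> f z" for z
  proof (cases "f z")
    case (real t)
    have "h z \<le> J z" using minor(3) by (rule le_funD)
    \<comment> \<open>The least-squares term of \<open>J\<close> cancels against that of
      \<open>q\<close>.\<close>
    then have "(z, t + \<gamma> / 2 * (norm z)\<^sup>2) \<in> E"
      using real by (simp add: E_def J_def least_squares_penalized_def q_def)
    from yc[OF this] show ?thesis using real unfolding y by simp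
  qed (use f[of z] in auto)
  then have "ereal (c + \<gamma> * inner (y /\<^sub>R \<gamma>) x - \<gamma> / 2 * (norm x)\<^sup>2)
      \<le> S_transform \<gamma> (S_transform \<gamma> f) x"
    by (rule S_transform_twice_ge)
  \<comment> \<open>Adding the least-squares term at \<open>x\<close> to the minorant gives at least
    \<rho>, against the choice of \<rho>.\<close>
  with x \<rho>(1) show False
    unfolding y least_squares_penalized_def q_def
    by (cases "S_transform \<gamma> (S_transform \<gamma> f) x") auto
qed

theorem proposition4p5:
  fixes A :: "'v::{real_inner, complete_space} \<Rightarrow> 'w::{real_inner, complete_space}"
    and d :: 'w
    and f :: "'v \<Rightarrow> ereal"
    and \<gamma> :: real
  assumes "separable_space (euclidean :: 'v topology)"
    and "separable_space (euclidean :: 'w topology)"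
    and "bounded_linear A"
    and "\<And>x. 0 \<le> f x"
    and "\<gamma> > 0"
    and "\<And>x. (norm (A x))\<^sup>2 \<le> \<gamma> * (norm x)\<^sup>2"
  shows "\<forall>x. CE (least_squares_penalized A d f) x
               \<le> least_squares_penalized A d (S_transform \<gamma> (S_transform \<gamma> f)) x
           \<and> least_squares_penalized A d (S_transform \<gamma> (S_transform \<gamma> f)) x
               \<le> least_squares_penalized A d f x"
  using CE_least_squares_le[OF assms(3-6)] S_transform_twice_le[of \<gamma> f]
  by (auto simp: least_squares_penalized_def intro: add_right_mono)

end
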